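(* Let $D\subset\mathbb{R}^\eta$ be a bounded polyhedron and let $f^k(x)=w^k\cdot x+b^k$, $k\in\{1,\dots,d\}$, be affine functions on $D$ that are irreducible (for every $k$ there is $x\in D$ with $f^k(x)>f^\ell(x)$ for all $\ell\ne k$). Then $R_{\mathrm{cayley}}$ is equal to the set of all $(x,y,z)\in D\times\mathbb{R}\times\Delta^d$ satisfying $$y\le\bar\alpha\cdot x+\sum_{k=1}^d\left(\max_{x^k\in D_{|k}}\{(w^k-\bar\alpha)\cdot x^k\}+b^k\right)z_k\qquad\forall\bar\alpha\in\mathbb{R}^\eta,$$ $$y\ge\underline\alpha\cdot x+\sum_{k=1}^d\left(\min_{x^k\in D_{|k}}\{(w^k-\underline\alpha)\cdot x^k\}+b^k\right)z_k\qquad\forall\underline\alpha\in\mathbb{R}^\eta.$$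
   Context: $\Delta^d=\{z\in\mathbb{R}^d_{\ge0}:\sum_k z_k=1\}$. $D_{|k}=\{x\in D: w^k\cdot x+b^k\ge w^\ell\cdot x+b^\ell\ \ \forall \ell\ne k\}$. The Cayley embedding is $R_{\mathrm{cayley}}=\operatorname{Conv}\left(\bigcup_{k=1}^d\{(x,f^k(x),\mathbf{e}^k): x\in D_{|k}\}\right)\subset\mathbb{R}^{\eta+1+d}$, where $\mathbf{e}^k$ is the $k$-th unit vector of $\mathbb{R}^d$. *)

theory Defs
  imports "HOL-Analysis.Analysis"
begin

text \<open>
  The type \<open>'n\<close> indexes the coordinates of the input space of dimension \<open>\<eta>\<close>; the type \<open>'d\<close> plays
  the role of the index set \<open>{1, ..., d}\<close> of the affine pieces.
\<close>

definition aff :: "('d \<Rightarrow> real^'n) \<Rightarrow> ('d \<Rightarrow> real) \<Rightarrow> 'd \<Rightarrow> real^'n \<Rightarrow> real" where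
  "aff w b k x = w k \<bullet> x + b k"

definition irreducible_on :: "(real^'n) set \<Rightarrow> ('d \<Rightarrow> real^'n) \<Rightarrow> ('d \<Rightarrow> real) \<Rightarrow> bool" where
  "irreducible_on D w b \<longleftrightarrow> (\<forall>k. \<exists>x\<in>D. \<forall>l. l \<noteq> k \<longrightarrow> aff w b k x > aff w b l x)"

definition piece :: "(real^'n) set \<Rightarrow> ('d \<Rightarrow> real^'n) \<Rightarrow> ('d \<Rightarrow> real) \<Rightarrow> 'd \<Rightarrow> (real^'n) set" where
  "piece D w b k = {x \<in> D. \<forall>l. l \<noteq> k \<longrightarrow> w k \<bullet> x + b k \<ge> w l \<bullet> x + b l}"

definition std_simplex :: "(real^'d) set" where
  "std_simplex = {z. (\<forall>k. z $ k \<ge> 0) \<and> (\<Sum>k\<in>UNIV. z $ k) = 1}"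

definition R_cayley ::
    "(real^'n) set \<Rightarrow> ('d \<Rightarrow> real^'n) \<Rightarrow> ('d \<Rightarrow> real) \<Rightarrow> ((real^'n) \<times> real \<times> (real^'d)) set" where
  "R_cayley D w b = convex hull (\<Union>k. {(x, aff w b k x, axis k 1) | x. x \<in> piece D w b k})"

text \<open>
  The maximum and minimum of a function over a (typically infinite) set, as the greatest and least
  element of the image. The library's \<open>Max\<close> and \<open>Min\<close> are only meaningful on finite sets.
  Like any definite description, these values are unspecified if no extremum is attained; here
  they are only used for affine functions on nonempty compact sets.
\<close>

definition max_over :: "'a set \<Rightarrow> ('a \<Rightarrow> real) \<Rightarrow> real" where
  "max_over S g = (GREATEST v. v \<in> g ` S)"

definition min_over :: "'a set \<Rightarrow> ('a \<Rightarrow> real) \<Rightarrow> real" where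
  "min_over S g = (LEAST v. v \<in> g ` S)"

lemma max_over_eqI:
  assumes "x \<in> S" "\<And>y. y \<in> S \<Longrightarrow> g y \<le> g x"
  shows "max_over S g = g x"
  unfolding max_over_def by (rule Greatest_equality) (use assms in auto)

lemma min_over_eqI:
  assumes "x \<in> S" "\<And>y. y \<in> S \<Longrightarrow> g x \<le> g y"
  shows "min_over S g = g x"
  unfolding min_over_def by (rule Least_equality) (use assms in auto)

end

theory Submission imports Defs begin

text \<open>
  The generators of the Cayley embedding satisfy the inequalities, which define a convex set.
  Conversely, a point outside the compact convex set \<open>R_cayley\<close> is strictly separated from it by a
  functional \<open>(a, c, e)\<close>. By boundedness this functional can be perturbed so that \<open>c \<noteq> 0\<close>. Averaging
  the separating inequality over optimal points of the pieces with weights \<open>z\<close> makes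
  the contribution of \<open>e\<close> cancel, so that the inequality for \<open>\<alpha> = - a / c\<close> is violated: the upper one
  if \<open>c > 0\<close> and the lower one if \<open>c < 0\<close>.
\<close>

lemma max_over_attained:
  fixes g :: "'a::topological_space \<Rightarrow> real"
  assumes "compact S" "S \<noteq> {}" "continuous_on S g"
  shows "\<exists>u\<in>S. max_over S g = g u" and "x \<in> S \<Longrightarrow> g x \<le> max_over S g"
proof -
  obtain u where u: "u \<in> S" "\<And>x. x \<in> S \<Longrightarrow> g x \<le> g u"
    using continuous_attains_sup[OF assms] by blast
  then have "max_over S g = g u"
    by (rule max_over_eqI)
  then show "\<exists>u\<in>S. max_over S g = g u" and "x \<in> S \<Longrightarrow> g x \<le> max_over S g"
    using u by auto
qed

lemma min_over_attained:
  fixes g :: "'a::topological_space \<Rightarrow> real"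
  assumes "compact S" "S \<noteq> {}" "continuous_on S g"
  shows "\<exists>u\<in>S. min_over S g = g u" and "x \<in> S \<Longrightarrow> min_over S g \<le> g x"
proof -
  obtain u where u: "u \<in> S" "\<And>x. x \<in> S \<Longrightarrow> g u \<le> g x"
    using continuous_attains_inf[OF assms] by blast
  then have "min_over S g = g u"
    by (rule min_over_eqI)
  then show "\<exists>u\<in>S. min_over S g = g u" and "x \<in> S \<Longrightarrow> min_over S g \<le> g x"
    using u by auto
qed

lemma compact_piece:
  assumes "compact D"
  shows "compact (piece D w b k)"
proof -
  have "piece D w b k = D \<inter> (\<Inter>l\<in>-{k}. {x. w l \<bullet> x + b l \<le> w k \<bullet> x + b k})"
    by (auto simp: piece_def)
  moreover have "closed (\<Inter>l\<in>-{k}. {x. w l \<bullet> x + b l \<le> w k \<bullet> x + b k})"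
    by (intro closed_INT ballI closed_Collect_le continuous_intros)
  ultimately show ?thesis
    using assms by (simp add: compact_Int_closed)
qed

lemma piece_nonempty:
  assumes "irreducible_on D w b"
  shows "piece D w b k \<noteq> {}"
  using assms unfolding irreducible_on_def piece_def aff_def by (force intro: less_imp_le)

lemma compact_R_cayley:
  fixes w :: "'d::finite \<Rightarrow> real^'n"
  assumes "compact D"
  shows "compact (R_cayley D w b)"
proof -
  have "compact {(x, aff w b k x, axis k 1 :: real^'d) |x. x \<in> piece D w b k}" for k
  proof -
    have "{(x, aff w b k x, axis k 1 :: real^'d) |x. x \<in> piece D w b k} =
        (\<lambda>x. (x, aff w b k x, axis k 1)) ` piece D w b k"
      by auto
    moreover have "continuous_on (piece D w b k) (\<lambda>x. (x, aff w b k x, axis k 1 :: real^'d))"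
      unfolding aff_def by (intro continuous_intros)
    ultimately show ?thesis
      using compact_continuous_image[OF _ compact_piece[OF assms]] by simp
  qed
  then show ?thesis
    unfolding R_cayley_def by (intro compact_convex_hull compact_UN finite)
qed

lemma convex_std_simplex: "convex (std_simplex :: (real^'d::finite) set)"
proof (rule convexI)
  fix x y :: "real^'d" and u v :: real
  assume "x \<in> std_simplex" "y \<in> std_simplex" "u \<ge> 0" "v \<ge> 0" "u + v = 1"
  moreover have "(\<Sum>k\<in>UNIV. (u *\<^sub>R x + v *\<^sub>R y) $ k) =
      u * (\<Sum>k\<in>UNIV. x $ k) + v * (\<Sum>k\<in>UNIV. y $ k)"
    by (simp add: sum.distrib sum_distrib_left)
  ultimately show "u *\<^sub>R x + v *\<^sub>R y \<in> std_simplex"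
    by (simp add: std_simplex_def)
qed

lemma convex_affine_le:
  fixes \<alpha> :: "'a::real_inner" and m :: "'d::finite \<Rightarrow> real"
  shows "convex {(x, y, z :: real^'d). y \<le> \<alpha> \<bullet> x + (\<Sum>k\<in>UNIV. m k * z $ k)}"
proof -
  have "(\<Sum>k\<in>UNIV. m k * z $ k) = (\<chi> k. m k) \<bullet> z" for z :: "real^'d"
    by (simp add: inner_vec_def)
  then have "{(x, y, z :: real^'d). y \<le> \<alpha> \<bullet> x + (\<Sum>k\<in>UNIV. m k * z $ k)} =
      {p. (- \<alpha>, 1 :: real, - (\<chi> k. m k)) \<bullet> p \<le> 0}"
    by (auto simp: algebra_simps)
  then show ?thesis
    by (simp only: convex_halfspace_le)
qed

lemma convex_affine_ge:
  fixes \<alpha> :: "'a::real_inner" and m :: "'d::finite \<Rightarrow> real"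
  shows "convex {(x, y, z :: real^'d). y \<ge> \<alpha> \<bullet> x + (\<Sum>k\<in>UNIV. m k * z $ k)}"
proof -
  have "(\<Sum>k\<in>UNIV. m k * z $ k) = (\<chi> k. m k) \<bullet> z" for z :: "real^'d"
    by (simp add: inner_vec_def)
  then have "{(x, y, z :: real^'d). y \<ge> \<alpha> \<bullet> x + (\<Sum>k\<in>UNIV. m k * z $ k)} =
      {p. (- \<alpha>, 1 :: real, - (\<chi> k. m k)) \<bullet> p \<ge> 0}"
    by (auto simp: algebra_simps)
  then show ?thesis
    by (simp only: convex_halfspace_ge)
qed

lemma nonvertical_separation:
  fixes S :: "('a::euclidean_space \<times> real \<times> 'c::euclidean_space) set"
  assumes "convex S" "compact S" "(x, y, z) \<notin> S"
  obtains a c e \<beta> where "c \<noteq> 0" "\<beta> < a \<bullet> x + c * y + e \<bullet> z"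
    "\<And>u v t. (u, v, t) \<in> S \<Longrightarrow> a \<bullet> u + c * v + e \<bullet> t \<le> \<beta>"
proof -
  obtain q \<gamma> where q: "q \<bullet> (x, y, z) < \<gamma>" "\<forall>p\<in>S. \<gamma> < q \<bullet> p"
    using separating_hyperplane_closed_point[OF assms(1) compact_imp_closed[OF assms(2)] assms(3)]
    by blast
  obtain a c e where qeq: "q = (a, c, e)"
    by (cases q)
  show thesis
  proof (cases "c = 0")
    case False
    show thesis
      by (rule that[of "- c" "- \<gamma>" "- a" "- e"]) (use False q qeq in force)+
  next
    case True
    obtain M where M: "M > 0" "\<forall>p\<in>S. norm p \<le> M"
      using compact_imp_bounded[OF assms(2)] unfolding bounded_pos by blast
    have v: "\<bar>v\<bar> \<le> M" if "(u, v, t) \<in> S" for u v t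
    proof -
      have "\<bar>v\<bar> \<le> norm (v, t)"
        using norm_fst_le[of v t] by simp
      also have "\<dots> \<le> norm (u, v, t)"
        using norm_snd_le by metis
      finally show ?thesis
        using M(2) that by fastforce
    qed
    define \<delta> where "\<delta> = \<gamma> - q \<bullet> (x, y, z)"
    define K where "K = M + \<bar>y\<bar>"
    define \<epsilon> where "\<epsilon> = \<delta> / (2 * K)"
    have "\<delta> > 0"
      using q(1) by (simp add: \<delta>_def)
    have "K > 0"
      using M(1) by (simp add: K_def)
    with \<open>\<delta> > 0\<close> have "\<epsilon> > 0" "\<epsilon> * K = \<delta> / 2"
      by (simp_all add: \<epsilon>_def)
    then have eps: "\<epsilon> * M + \<epsilon> * \<bar>y\<bar> = \<delta> / 2"
      by (simp add: K_def distrib_left)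
    show thesis
    proof (rule that[of \<epsilon> "- \<gamma> + \<epsilon> * M" "- a" "- e"])
      show "\<epsilon> \<noteq> 0"
        using \<open>\<epsilon> > 0\<close> by simp
      have "\<epsilon> * (- y) \<le> \<epsilon> * \<bar>y\<bar>"
        using \<open>\<epsilon> > 0\<close> by (intro mult_left_mono) auto
      then show "- \<gamma> + \<epsilon> * M < - a \<bullet> x + \<epsilon> * y + - e \<bullet> z"
        using eps \<open>\<delta> > 0\<close> by (simp add: \<delta>_def qeq True)
    next
      fix u v t
      assume S: "(u, v, t) \<in> S"
      have "\<epsilon> * v \<le> \<epsilon> * M"
        using \<open>\<epsilon> > 0\<close> v[OF S] by (intro mult_left_mono) auto
      moreover have "\<gamma> < a \<bullet> u + e \<bullet> t"
        using q(2) S by (force simp: qeq True)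
      ultimately show "- a \<bullet> u + \<epsilon> * v + - e \<bullet> t \<le> - \<gamma> + \<epsilon> * M"
        by simp
    qed
  qed
qed

lemma R_cayley_separation:
  fixes w :: "'d::finite \<Rightarrow> real^'n"
  assumes "compact D" "z \<in> std_simplex" "(x, y, z) \<notin> R_cayley D w b"
  obtains \<alpha> c where "c \<noteq> 0"
    "\<forall>u. (\<forall>k. u k \<in> piece D w b k) \<longrightarrow>
      c * (\<Sum>k\<in>UNIV. ((w k - \<alpha>) \<bullet> u k + b k) * z $ k) < c * (y - \<alpha> \<bullet> x)"
proof -
  have "convex (R_cayley D w b)"
    by (simp add: R_cayley_def)
  then obtain a c e \<beta> where c: "c \<noteq> 0" and \<beta>: "\<beta> < a \<bullet> x + c * y + e \<bullet> z"
    and R: "\<And>u v t. (u, v, t) \<in> R_cayley D w b \<Longrightarrow> a \<bullet> u + c * v + e \<bullet> t \<le> \<beta>"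
    using nonvertical_separation compact_R_cayley[OF assms(1)] assms(3) by metis
  define \<alpha> where "\<alpha> = (- 1 / c) *\<^sub>R a"
  have a: "a = - c *\<^sub>R \<alpha>"
    using c by (simp add: \<alpha>_def)
  have z: "\<And>k. z $ k \<ge> 0" "(\<Sum>k\<in>UNIV. z $ k) = 1"
    using assms(2) by (auto simp: std_simplex_def)
  show thesis
  proof (rule that[OF c], intro allI impI)
    fix u
    assume u: "\<forall>k. u k \<in> piece D w b k"
    have le: "c * ((w k - \<alpha>) \<bullet> u k + b k) + e $ k \<le> \<beta>" for k
    proof -
      have "(u k, aff w b k (u k), axis k 1) \<in> R_cayley D w b"
        unfolding R_cayley_def using u by (intro hull_inc) blast
      from R[OF this] show ?thesis
        by (simp add: a aff_def inner_axis algebra_simps)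
    qed
    have "e \<bullet> z = (\<Sum>k\<in>UNIV. e $ k * z $ k)"
      by (simp add: inner_vec_def)
    then have "c * (\<Sum>k\<in>UNIV. ((w k - \<alpha>) \<bullet> u k + b k) * z $ k) + e \<bullet> z =
        (\<Sum>k\<in>UNIV. (c * ((w k - \<alpha>) \<bullet> u k + b k) + e $ k) * z $ k)"
      by (simp add: sum_distrib_left distrib_left distrib_right sum.distrib mult.assoc)
    also have "\<dots> \<le> (\<Sum>k\<in>UNIV. \<beta> * z $ k)"
      by (intro sum_mono mult_right_mono le z)
    also have "\<dots> = \<beta>"
      by (simp add: z flip: sum_distrib_left)
    finally show "c * (\<Sum>k\<in>UNIV. ((w k - \<alpha>) \<bullet> u k + b k) * z $ k) < c * (y - \<alpha> \<bullet> x)"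
      using \<beta> by (simp add: a algebra_simps)
  qed
qed

theorem proposition4:
  fixes D :: "(real^'n) set" and w :: "'d::finite \<Rightarrow> real^'n" and b :: "'d \<Rightarrow> real"
  assumes "polyhedron D" and "bounded D"
    and "irreducible_on D w b"
  shows "R_cayley D w b =
    {(x, y, z). x \<in> D \<and> z \<in> std_simplex \<and>
      (\<forall>\<alpha>. y \<le> \<alpha> \<bullet> x + (\<Sum>k\<in>UNIV. (max_over (piece D w b k) (\<lambda>u. (w k - \<alpha>) \<bullet> u) + b k) * z $ k)) \<and>
      (\<forall>\<alpha>. y \<ge> \<alpha> \<bullet> x + (\<Sum>k\<in>UNIV. (min_over (piece D w b k) (\<lambda>u. (w k - \<alpha>) \<bullet> u) + b k) * z $ k))}"
proof (rule equalityI)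
  have D: "compact D"
    using assms(1,2) by (simp add: compact_eq_bounded_closed polyhedron_imp_closed)
  have cont: "continuous_on S (\<lambda>u. (w k - \<alpha>) \<bullet> u)" for S k \<alpha>
    by (intro continuous_intros)
  note max_attained = max_over_attained[OF compact_piece[OF D] piece_nonempty[OF assms(3)] cont]
  note min_attained = min_over_attained[OF compact_piece[OF D] piece_nonempty[OF assms(3)] cont]
  let ?U = "\<lambda>\<alpha> k. max_over (piece D w b k) (\<lambda>u. (w k - \<alpha>) \<bullet> u) + b k"
  let ?L = "\<lambda>\<alpha> k. min_over (piece D w b k) (\<lambda>u. (w k - \<alpha>) \<bullet> u) + b k"
  let ?Q = "{(x, y, z). x \<in> D \<and> z \<in> std_simplex \<and>
      (\<forall>\<alpha>. y \<le> \<alpha> \<bullet> x + (\<Sum>k\<in>UNIV. ?U \<alpha> k * z $ k)) \<and>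
      (\<forall>\<alpha>. y \<ge> \<alpha> \<bullet> x + (\<Sum>k\<in>UNIV. ?L \<alpha> k * z $ k))}"
  show "R_cayley D w b \<subseteq> ?Q"
    unfolding R_cayley_def
  proof (rule hull_minimal)
    have "?Q = (D \<times> UNIV \<times> std_simplex) \<inter>
        ((\<Inter>\<alpha>. {(x, y, z). y \<le> \<alpha> \<bullet> x + (\<Sum>k\<in>UNIV. ?U \<alpha> k * z $ k)}) \<inter>
         (\<Inter>\<alpha>. {(x, y, z). y \<ge> \<alpha> \<bullet> x + (\<Sum>k\<in>UNIV. ?L \<alpha> k * z $ k)}))"
      by auto
    moreover have "convex \<dots>"
      by (intro convex_Int convex_INT convex_Times convex_UNIV convex_std_simplex
          polyhedron_imp_convex assms(1) convex_affine_le convex_affine_ge)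
    ultimately show "convex ?Q"
      by simp
  next
    have simplex: "axis k 1 \<in> (std_simplex :: (real^'d) set)" for k
      by (simp add: std_simplex_def axis_def)
    have pick: "(\<Sum>j\<in>UNIV. m j * (axis k 1 :: real^'d) $ j) = m k" for m k
      by (simp add: axis_def if_distrib[of "(*) _"] cong: if_cong)
    have "aff w b k x \<le> \<alpha> \<bullet> x + ?U \<alpha> k" "aff w b k x \<ge> \<alpha> \<bullet> x + ?L \<alpha> k"
      if "x \<in> piece D w b k" for k x \<alpha>
    proof -
      show "aff w b k x \<le> \<alpha> \<bullet> x + ?U \<alpha> k"
        using max_attained(2)[OF that, of k \<alpha>] by (simp add: aff_def inner_diff_left)
      show "aff w b k x \<ge> \<alpha> \<bullet> x + ?L \<alpha> k"
        using min_attained(2)[OF that, of k \<alpha>] by (simp add: aff_def inner_diff_left)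
    qed
    then show "(\<Union>k. {(x, aff w b k x, axis k 1) |x. x \<in> piece D w b k}) \<subseteq> ?Q"
      by (auto simp: pick simplex piece_def)
  qed
  show "?Q \<subseteq> R_cayley D w b"
  proof clarify
    fix x y z
    assume z: "z \<in> std_simplex"
      and upper: "\<forall>\<alpha>. y \<le> \<alpha> \<bullet> x + (\<Sum>k\<in>UNIV. ?U \<alpha> k * z $ k)"
      and lower: "\<forall>\<alpha>. y \<ge> \<alpha> \<bullet> x + (\<Sum>k\<in>UNIV. ?L \<alpha> k * z $ k)"
    show "(x, y, z) \<in> R_cayley D w b"
    proof (rule ccontr)
      assume "(x, y, z) \<notin> R_cayley D w b"
      then obtain \<alpha> c where "c \<noteq> 0"
        and sep: "\<forall>u. (\<forall>k. u k \<in> piece D w b k) \<longrightarrow>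
          c * (\<Sum>k\<in>UNIV. ((w k - \<alpha>) \<bullet> u k + b k) * z $ k) < c * (y - \<alpha> \<bullet> x)"
        by (rule R_cayley_separation[OF D z])
      from \<open>c \<noteq> 0\<close> consider "c > 0" | "c < 0"
        by linarith
      then show False
      proof cases
        case 1
        have "\<exists>u. \<forall>k. u k \<in> piece D w b k \<and>
            max_over (piece D w b k) (\<lambda>u. (w k - \<alpha>) \<bullet> u) = (w k - \<alpha>) \<bullet> u k"
          by (intro choice allI max_attained(1)[unfolded Bex_def])
        then obtain u where "\<And>k. u k \<in> piece D w b k"
          "\<And>k. max_over (piece D w b k) (\<lambda>u. (w k - \<alpha>) \<bullet> u) = (w k - \<alpha>) \<bullet> u k"
          by blast
        then have "c * (\<Sum>k\<in>UNIV. ?U \<alpha> k * z $ k) < c * (y - \<alpha> \<bullet> x)"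
          using sep[rule_format, of u] by simp
        then show False
          using upper[rule_format, of \<alpha>] 1 by simp
      next
        case 2
        have "\<exists>u. \<forall>k. u k \<in> piece D w b k \<and>
            min_over (piece D w b k) (\<lambda>u. (w k - \<alpha>) \<bullet> u) = (w k - \<alpha>) \<bullet> u k"
          by (intro choice allI min_attained(1)[unfolded Bex_def])
        then obtain u where "\<And>k. u k \<in> piece D w b k"
          "\<And>k. min_over (piece D w b k) (\<lambda>u. (w k - \<alpha>) \<bullet> u) = (w k - \<alpha>) \<bullet> u k"
          by blast
        then have "c * (\<Sum>k\<in>UNIV. ?L \<alpha> k * z $ k) < c * (y - \<alpha> \<bullet> x)"
          using sep[rule_format, of u] by simp
        then show False
          using lower[rule_format, of \<alpha>] 2 by simp
      qed
    qed
  qed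
qed

end
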